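(* Let $\Omega\subset\mathbb{C}$ be a bounded, open and simply connected domain with two marked boundary points $a,b\in\partial\Omega$. Let $\varphi:\Omega\to\tilde\Omega$ be a conformal map such that $\varphi(a)=\tilde a$ and $\varphi(b)=\tilde b$, where $\tilde a,\tilde b\in\partial\tilde\Omega$. Let $m:\Omega\to\mathbb{R}_+$ be a bounded and continuous function. If $\gamma$ has the law of a massive SLE$_4$ curve in $\Omega$ from $a$ to $b$ with mass $m$, then $\varphi(\gamma)$ has the law of a massive SLE$_4$ curve in $\tilde\Omega$ from $\tilde a$ to $\tilde b$ with mass $\tilde m:\tilde\Omega\to\mathbb{R}_+$ given by $$\tilde m^2(\tilde w)=|(\varphi^{-1})'(\tilde w)|^2\,m^2(\varphi^{-1}(\tilde w)),\qquad \tilde w\in\tilde\Omega .$$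
   Context: Boundary points are understood as prime ends. $\mathbb{H}=\{\Im z>0\}$. **Massive SLE$_4$.** Let $D$ be a simply connected domain with boundary points $x,y$, and $\mu:D\to\mathbb{R}_+$ a mass function. Let $\phi_D:D\to\mathbb{H}$ be conformal with $\phi_D(x)=0$, $\phi_D(y)=\infty$. A curve $\gamma$ in $D$ from $x$ to $y$ has the law of massive SLE$_4$ with mass $\mu$ if $\phi_D(\gamma)$, parametrized by half-plane capacity, is the Loewner chain $\partial_tg_t(z)=\frac{2}{g_t(z)-W_t}$, $g_0(z)=z$, with hulls $K_t$ and driving function solving $$dW_t=2\,dB_t-2\pi\Big(\int_{D_t}\mu^2(w)P_t^\mu(w)h_t(w)\,dw\Big)dt,\qquad W_0=0,$$ with $B$ a standard one-dimensional Brownian motion, where $D_t=\phi_D^{-1}(\mathbb{H}\setminus K_t)$, $f_t=g_t-W_t$, $h_t(z)=\frac1\pi\arg f_t(\phi_D(z))-\frac12$, $G_t^\mu$ is the inverse, in the sense of distributions, of $-\Delta+\mu^2$ with Dirichlet boundary conditions in $D_t$, and $$P_t^\mu(z)=\tfrac1\pi\Im\Big(\tfrac{-1}{f_t(\phi_D(z))}\Big)-\int_{D_t}\mu^2(w)\,\tfrac1\pi\Im\Big(\tfrac{-1}{f_t(\phi_D(w))}\Big)G_t^\mu(z,w)\,dw.$$ This definition is used for $(\Omega,a,b,m)$ and, with the (possibly unbounded) domain $\tilde\Omega$, for $(\tilde\Omega,\tilde a,\tilde b,\tilde m)$. *)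

theory Defs
  imports "HOL-Probability.Probability" "HOL-Complex_Analysis.Complex_Analysis"
begin

section \<open>Conformal maps and prime ends\<close>

definition upper_half_plane :: "complex set" where
  "upper_half_plane = {z. 0 < Im z}"

definition conformal_map :: "complex set \<Rightarrow> complex set \<Rightarrow> (complex \<Rightarrow> complex) \<Rightarrow> bool" where
  "conformal_map D E f \<longleftrightarrow> f holomorphic_on D \<and> bij_betw f D E"

text \<open>Domains may be unbounded, so prime ends are taken with respect to the Riemann sphere:
  diameters are measured in the chordal metric, and \<open>\<infinity>\<close> is a boundary point of every unbounded
  domain.\<close>

definition chordal_dist :: "complex \<Rightarrow> complex \<Rightarrow> real" where
  "chordal_dist z w = 2 * cmod (z - w) / (sqrt (1 + (cmod z)\<^sup>2) * sqrt (1 + (cmod w)\<^sup>2))"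

definition ends_on_boundary :: "complex set \<Rightarrow> (real \<Rightarrow> complex) \<Rightarrow> real filter \<Rightarrow> bool" where
  "ends_on_boundary D c F \<longleftrightarrow>
     (\<exists>p\<in>frontier D. (c \<longlongrightarrow> p) F) \<or> filterlim c at_infinity F"

text \<open>A crosscut is an open Jordan arc; its two endpoints on the boundary may coincide.\<close>

definition crosscut :: "complex set \<Rightarrow> complex set \<Rightarrow> bool" where
  "crosscut D C \<longleftrightarrow>
     (\<exists>c. continuous_on {0<..<1} c \<and> inj_on c {0<..<1} \<and> c ` {0<..<1} = C \<and> C \<subseteq> D \<and>
          ends_on_boundary D c (at_right 0) \<and> ends_on_boundary D c (at_left 1))"

definition separates_in :: "complex set \<Rightarrow> complex set \<Rightarrow> complex set \<Rightarrow> complex set \<Rightarrow> bool" where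
  "separates_in D S A B \<longleftrightarrow> A \<subseteq> D - S \<and> B \<subseteq> D - S \<and>
     (\<forall>u\<in>A. \<forall>v\<in>B. \<not> connected_component (D - S) u v)"

text \<open>Null-chains as in Pommerenke, \<^emph>\<open>Boundary Behaviour of Conformal Maps\<close>, Section 2.4. The second
  conjunct says that consecutive crosscuts have disjoint closures in the sphere: the closures
  share the point \<open>\<infinity>\<close> iff both sets are unbounded.\<close>

definition null_chain :: "complex set \<Rightarrow> (nat \<Rightarrow> complex set) \<Rightarrow> bool" where
  "null_chain D C \<longleftrightarrow>
     (\<forall>n. crosscut D (C n)) \<and>
     (\<forall>n. closure (C n) \<inter> closure (C (Suc n)) = {} \<and> (bounded (C n) \<or> bounded (C (Suc n)))) \<and>
     (\<forall>n\<ge>1. separates_in D (C n) (C 0) (C (Suc n))) \<and>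
     (\<forall>\<epsilon>>0. \<forall>\<^sub>F n in sequentially. \<forall>z\<in>C n. \<forall>w\<in>C n. chordal_dist z w < \<epsilon>)"

text \<open>The component of \<open>D - C n\<close> that contains the later crosscuts.\<close>

definition chain_region :: "complex set \<Rightarrow> (nat \<Rightarrow> complex set) \<Rightarrow> nat \<Rightarrow> complex set" where
  "chain_region D C n = {z. \<exists>w\<in>C (Suc n). connected_component (D - C n) w z}"

text \<open>Two null-chains are equivalent iff each region of either one contains a region of the other,
  that is, iff their decreasing sequences of regions generate the same filter. A prime end is
  therefore represented by this filter, and ``\<open>z\<close> tends to the prime end \<open>x\<close> in \<open>D\<close>'' is convergence
  along the filter \<open>x\<close>. A conformal map \<open>\<phi>\<close> of \<open>D\<close> sends \<open>x\<close> to the prime end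
  \<open>filtermap \<phi> x\<close> of the image: this is the Caratheodory extension of \<open>\<phi>\<close>.\<close>

definition prime_end :: "complex set \<Rightarrow> complex filter \<Rightarrow> bool" where
  "prime_end D x \<longleftrightarrow>
     (\<exists>C. null_chain D C \<and> x = (INF n\<in>{1..}. principal (chain_region D C n)))"

text \<open>The prime ends \<open>0\<close> and \<open>\<infinity>\<close> of the upper half-plane.\<close>

definition H_zero :: "complex filter" where
  "H_zero = inf (nhds 0) (principal upper_half_plane)"

definition H_infinity :: "complex filter" where
  "H_infinity = inf at_infinity (principal upper_half_plane)"

text \<open>Curves run through \<open>D\<close> itself and tend to the prime ends \<open>x\<close> and \<open>y\<close> at the two ends of the
  (immaterial) parameter interval \<open>(0,1)\<close>.\<close>

definition curve_in :: "complex set \<Rightarrow> complex filter \<Rightarrow> complex filter \<Rightarrow> (real \<Rightarrow> complex) \<Rightarrow> bool" where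
  "curve_in D x y c \<longleftrightarrow>
     continuous_on {0<..<1} c \<and> c ` {0<..<1} \<subseteq> D \<and>
     filterlim c x (at_right 0) \<and> filterlim c y (at_left 1)"

section \<open>Chordal Loewner chains\<close>

definition loewner_solution :: "(real \<Rightarrow> real) \<Rightarrow> real \<Rightarrow> complex \<Rightarrow> (real \<Rightarrow> complex) \<Rightarrow> bool" where
  "loewner_solution W T z u \<longleftrightarrow> u 0 = z \<and>
     (\<forall>t\<in>{0..T}. u t \<noteq> of_real (W t) \<and>
        (u has_vector_derivative 2 / (u t - of_real (W t))) (at t within {0..T}))"

definition loewner_hull :: "(real \<Rightarrow> real) \<Rightarrow> real \<Rightarrow> complex set" where
  "loewner_hull W t = {z \<in> upper_half_plane. \<nexists>u. loewner_solution W t z u}"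

text \<open>Meaningful for \<open>z\<close> in the upper half-plane outside \<open>loewner_hull W t\<close>, where the solution is
  unique.\<close>

definition loewner_map :: "(real \<Rightarrow> real) \<Rightarrow> real \<Rightarrow> complex \<Rightarrow> complex" where
  "loewner_map W t z = (THE v. \<exists>u. loewner_solution W t z u \<and> u t = v)"

text \<open>The complement in the half-plane of the unbounded component of the half-plane minus \<open>A\<close>.\<close>

definition half_plane_fill :: "complex set \<Rightarrow> complex set" where
  "half_plane_fill A = upper_half_plane -
     {z \<in> upper_half_plane - A. \<not> bounded (connected_component_set (upper_half_plane - A) z)}"

text \<open>The curve \<open>c\<close>, parametrized by half-plane capacity, is the Loewner chain driven by \<open>W\<close>:
  up to the (weakly increasing) time change \<open>\<tau>\<close>, \<open>c\<close> is a curve \<open>\<eta>\<close> generating the hulls of the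
  chain. The normalization of Loewner's equation gives the hull at time \<open>t\<close> half-plane capacity
  \<open>2 * t\<close>, so \<open>\<tau> s\<close> is half the capacity of \<open>c\<close> up to parameter \<open>s\<close>.\<close>

definition loewner_curve :: "(real \<Rightarrow> real) \<Rightarrow> (real \<Rightarrow> complex) \<Rightarrow> bool" where
  "loewner_curve W c \<longleftrightarrow>
     (\<exists>\<eta> \<tau>. continuous_on {0<..} \<eta> \<and> \<eta> ` {0<..} \<subseteq> upper_half_plane \<and>
        (\<forall>t>0. loewner_hull W t = half_plane_fill (\<eta> ` {0<..t})) \<and>
        continuous_on {0<..<1} \<tau> \<and> mono_on {0<..<1} \<tau> \<and> \<tau> ` {0<..<1} = {0<..} \<and>
        (\<forall>s\<in>{0<..<1}. c s = \<eta> (\<tau> s)))"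

section \<open>Massive Green function\<close>

definition partial_deriv :: "complex \<Rightarrow> (complex \<Rightarrow> real) \<Rightarrow> complex \<Rightarrow> real" where
  "partial_deriv v f z = frechet_derivative f (at z) v"

primrec Ck :: "nat \<Rightarrow> (complex \<Rightarrow> real) \<Rightarrow> bool" where
  "Ck 0 f \<longleftrightarrow> continuous_on UNIV f"
| "Ck (Suc k) f \<longleftrightarrow> (\<forall>z. f differentiable at z) \<and> (\<forall>v. Ck k (partial_deriv v f))"

definition test_function :: "complex set \<Rightarrow> (complex \<Rightarrow> real) \<Rightarrow> bool" where
  "test_function U \<psi> \<longleftrightarrow> (\<forall>k. Ck k \<psi>) \<and>
     compact (closure {z. \<psi> z \<noteq> 0}) \<and> closure {z. \<psi> z \<noteq> 0} \<subseteq> U"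

definition laplacian :: "(complex \<Rightarrow> real) \<Rightarrow> complex \<Rightarrow> real" where
  "laplacian f z =
     partial_deriv 1 (partial_deriv 1 f) z + partial_deriv \<i> (partial_deriv \<i> f) z"

text \<open>\<open>G\<close> is the inverse of \<open>- \<Delta> + \<mu>\<^sup>2\<close> in \<open>U\<close>: \<open>(- \<Delta> + \<mu>\<^sup>2) (G z) = \<delta>\<^sub>z\<close> in the sense
  of distributions, with zero boundary values on the boundary of \<open>U\<close> in the Riemann sphere (for
  unbounded \<open>U\<close> this includes \<open>\<infinity>\<close>, without which \<open>G\<close> would not be unique). The value of \<open>G\<close> on
  the diagonal is irrelevant.\<close>

definition massive_green ::
  "complex set \<Rightarrow> (complex \<Rightarrow> real) \<Rightarrow> (complex \<Rightarrow> complex \<Rightarrow> real) \<Rightarrow> bool" where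
  "massive_green U \<mu> G \<longleftrightarrow> (\<forall>z\<in>U.
     continuous_on (U - {z}) (G z) \<and>
     (\<forall>C. compact C \<and> C \<subseteq> U \<longrightarrow> set_integrable lborel C (G z)) \<and>
     (\<forall>\<psi>. test_function U \<psi> \<longrightarrow>
        (LINT w:U|lborel. G z w * (- laplacian \<psi> w + (\<mu> w)\<^sup>2 * \<psi> w)) = \<psi> z) \<and>
     (\<forall>\<epsilon>>0. \<exists>C. compact C \<and> C \<subseteq> U \<and> (\<forall>w\<in>U - C. \<bar>G z w\<bar> < \<epsilon>)))"

section \<open>Massive SLE(4)\<close>

text \<open>In this section \<open>U\<close> is the slit domain, \<open>f\<close> the conformal map from \<open>U\<close> onto the upper
  half-plane sending the tip to \<open>0\<close> and the target to \<open>\<infinity>\<close>, \<open>\<mu>\<close> the mass and \<open>G\<close> the massive Green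
  function of \<open>U\<close>.\<close>

definition poisson_tip :: "(complex \<Rightarrow> complex) \<Rightarrow> complex \<Rightarrow> real" where
  "poisson_tip f z = Im (- 1 / f z) / pi"

definition massive_poisson_tip ::
  "complex set \<Rightarrow> (complex \<Rightarrow> complex) \<Rightarrow> (complex \<Rightarrow> real) \<Rightarrow> (complex \<Rightarrow> complex \<Rightarrow> real)
    \<Rightarrow> complex \<Rightarrow> real" where
  "massive_poisson_tip U f \<mu> G z =
     poisson_tip f z - (LINT w:U|lborel. (\<mu> w)\<^sup>2 * poisson_tip f w * G z w)"

definition harmonic_height :: "(complex \<Rightarrow> complex) \<Rightarrow> complex \<Rightarrow> real" where
  "harmonic_height f z = Arg (f z) / pi - 1 / 2"

definition drift_integral ::
  "complex set \<Rightarrow> (complex \<Rightarrow> complex) \<Rightarrow> (complex \<Rightarrow> real) \<Rightarrow> (complex \<Rightarrow> complex \<Rightarrow> real) \<Rightarrow> real" where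
  "drift_integral U f \<mu> G =
     (LINT w:U|lborel. (\<mu> w)\<^sup>2 * massive_poisson_tip U f \<mu> G w * harmonic_height f w)"

definition drift_integrable ::
  "complex set \<Rightarrow> (complex \<Rightarrow> complex) \<Rightarrow> (complex \<Rightarrow> real) \<Rightarrow> (complex \<Rightarrow> complex \<Rightarrow> real) \<Rightarrow> bool" where
  "drift_integrable U f \<mu> G \<longleftrightarrow>
     (\<forall>z\<in>U. set_integrable lborel U (\<lambda>w. (\<mu> w)\<^sup>2 * poisson_tip f w * G z w)) \<and>
     set_integrable lborel U (\<lambda>w. (\<mu> w)\<^sup>2 * massive_poisson_tip U f \<mu> G w * harmonic_height f w)"

definition brownian_motion ::
  "'w measure \<Rightarrow> (real \<Rightarrow> 'w measure) \<Rightarrow> (real \<Rightarrow> 'w \<Rightarrow> real) \<Rightarrow> bool" where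
  "brownian_motion M F B \<longleftrightarrow>
     prob_space M \<and> filtration (space M) F \<and> (\<forall>t\<ge>0. subalgebra M (F t)) \<and>
     (\<forall>t\<ge>0. B t \<in> borel_measurable (F t)) \<and>
     (AE \<omega> in M. B 0 \<omega> = 0 \<and> continuous_on {0..} (\<lambda>t. B t \<omega>)) \<and>
     (\<forall>s t. 0 \<le> s \<and> s < t \<longrightarrow>
        distributed M lborel (\<lambda>\<omega>. B t \<omega> - B s \<omega>) (normal_density 0 (sqrt (t - s))) \<and>
        prob_space.indep_set M
          (sets (vimage_algebra (space M) (\<lambda>\<omega>. B t \<omega> - B s \<omega>) borel)) (sets (F s)))"

definition slit_domain ::
  "complex set \<Rightarrow> (complex \<Rightarrow> complex) \<Rightarrow> (real \<Rightarrow> real) \<Rightarrow> real \<Rightarrow> complex set" where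
  "slit_domain D \<phi> W t = {z \<in> D. \<phi> z \<in> upper_half_plane - loewner_hull W t}"

definition centered_map :: "(complex \<Rightarrow> complex) \<Rightarrow> (real \<Rightarrow> real) \<Rightarrow> real \<Rightarrow> complex \<Rightarrow> complex" where
  "centered_map \<phi> W t z = loewner_map W t (\<phi> z) - of_real (W t)"

text \<open>Pathwise content of the definition: \<open>c\<close> is the curve in \<open>D\<close>, \<open>W\<close> its driving function, \<open>G t\<close>
  the massive Green function at time \<open>t\<close>. As the noise is additive, the stochastic differential
  equation is the integral equation in the last conjunct. The drift need not be finite at
  exceptional times (such as \<open>t = 0\<close>, when \<open>D\<close> is thin at the starting point).\<close>

definition massive_loewner_path ::
  "complex set \<Rightarrow> (complex \<Rightarrow> real) \<Rightarrow> (complex \<Rightarrow> complex) \<Rightarrow> (real \<Rightarrow> complex) \<Rightarrow> (real \<Rightarrow> real)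
    \<Rightarrow> (real \<Rightarrow> real) \<Rightarrow> (real \<Rightarrow> complex \<Rightarrow> complex \<Rightarrow> real) \<Rightarrow> bool" where
  "massive_loewner_path D \<mu> \<phi> c W B G \<longleftrightarrow>
     (let U = slit_domain D \<phi> W;
          f = centered_map \<phi> W;
          drift = (\<lambda>t. drift_integral (U t) (f t) \<mu> (G t))
      in W 0 = 0 \<and> continuous_on {0..} W \<and>
         loewner_curve W (\<lambda>s. \<phi> (c s)) \<and>
         (\<forall>t\<ge>0. massive_green (U t) \<mu> (G t)) \<and>
         (AE t in lborel. 0 \<le> t \<longrightarrow> drift_integrable (U t) (f t) \<mu> (G t)) \<and>
         (\<forall>t\<ge>0. set_integrable lborel {0..t} drift \<and>
                W t = 2 * B t - 2 * pi * (LINT s:{0..t}|lborel. drift s)))"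

text \<open>The random curve \<open>\<gamma>\<close>, defined on the probability space \<open>M\<close>, has the law of massive SLE(4) in
  \<open>D\<close> from \<open>x\<close> to \<open>y\<close> with mass \<open>\<mu>\<close>. The uniformizing map \<open>\<phi>\<close> is unique up to scaling, which does
  not affect the notion.\<close>

definition has_massive_SLE4_law ::
  "'w measure \<Rightarrow> ('w \<Rightarrow> real \<Rightarrow> complex) \<Rightarrow> complex set \<Rightarrow> complex filter \<Rightarrow> complex filter
    \<Rightarrow> (complex \<Rightarrow> real) \<Rightarrow> bool" where
  "has_massive_SLE4_law M \<gamma> D x y \<mu> \<longleftrightarrow>
     prob_space M \<and>
     (\<forall>s\<in>{0<..<1}. (\<lambda>\<omega>. \<gamma> \<omega> s) \<in> borel_measurable M) \<and>
     (\<forall>\<omega>\<in>space M. curve_in D x y (\<gamma> \<omega>)) \<and>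
     (\<exists>\<phi>. conformal_map D upper_half_plane \<phi> \<and>
        filtermap \<phi> x = H_zero \<and> filtermap \<phi> y = H_infinity \<and>
        (\<exists>F B W G. brownian_motion M F B \<and>
           (\<forall>t\<ge>0. W t \<in> borel_measurable (F t)) \<and>
           (AE \<omega> in M. massive_loewner_path D \<mu> \<phi> (\<gamma> \<omega>)
              (\<lambda>t. W t \<omega>) (\<lambda>t. B t \<omega>) (G \<omega>))))"

end

theory Submission
  imports Defs
begin

text \<open>Precompose the uniformizing map of \<open>\<Omega>\<close> with \<open>\<phi>\<^sup>-\<^sup>1\<close> to get one of \<open>\<Omega>'\<close>. The Loewner chain in the
  half-plane is then literally unchanged, and so are the driving function, the Brownian motion and the
  centered maps, up to the identification of the slit domains by \<open>\<phi>\<close>. Only the drift has to be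
  compared. The Laplacian of \<open>\<psi> \<circ> \<phi>\<close> is \<open>\<bar>\<phi>'\<bar>\<^sup>2\<close> times that of \<open>\<psi>\<close>, and \<open>\<bar>\<phi>'\<bar>\<^sup>2\<close> is both the Jacobian
  of \<open>\<phi>\<close> and the factor by which the squared mass changes. Hence the massive Green function is
  invariant, \<open>G' (\<phi> z) (\<phi> w) = G z w\<close>, the factors cancel in both area integrals over the slit
  domain, and the drift is the same.\<close>

subsection \<open>Change of variables for holomorphic maps\<close>

text \<open>Both measures agree on boxes, whose preimages are boxes. This moves the Jacobian
  formula, stated with determinants on \<open>real^2\<close>, to the complex plane.\<close>

lemma distr_lborel_Complex:
  "distr lborel borel (\<lambda>v::real^2. Complex (vec_nth v 1) (vec_nth v 2)) = lborel"
proof (rule lborel_eqI[symmetric])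
  let ?T = "\<lambda>v::real^2. Complex (vec_nth v 1) (vec_nth v 2)"
  fix l u :: complex
  assume le: "\<And>b. b \<in> Basis \<Longrightarrow> l \<bullet> b \<le> u \<bullet> b"
  have le': "Re l \<le> Re u" "Im l \<le> Im u"
    using le[of 1] le[of \<i>] by (auto simp: Basis_complex_def inner_complex_def)
  have meas: "?T \<in> borel_measurable borel"
    by (intro borel_measurable_continuous_onI continuous_intros)
  let ?l = "vector [Re l, Im l] :: real^2" and ?u = "vector [Re u, Im u] :: real^2"
  have pre: "?T -` box l u = box ?l ?u"
    by (auto simp: mem_box_cart in_box_complex_iff forall_2)
  have "emeasure (distr lborel borel ?T) (box l u) = emeasure lborel (box ?l ?u)"
    using meas by (simp add: emeasure_distr pre)
  also have "\<dots> = ennreal ((Re u - Re l) * (Im u - Im l))"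
    using le' by (simp add: emeasure_lborel_box_eq Basis_vec_def UNIV_2 prod.UNION_disjoint axis_eq_axis
        inner_axis inner_diff_left ennreal_mult mult.commute)
  finally show "emeasure (distr lborel borel ?T) (box l u) = (\<Prod>b\<in>Basis. (u - l) \<bullet> b)"
    by (simp add: Basis_complex_def inner_complex_def)
qed simp

text \<open>The image under \<open>f\<close> is a preimage under the holomorphic inverse, and
  preimages under continuous maps are Borel.\<close>

lemma borel_holomorphic_image:
  fixes f :: "complex \<Rightarrow> complex"
  assumes "f holomorphic_on S" "open S" "inj_on f S" and A: "A \<in> sets borel" "A \<subseteq> S"
  shows "f ` A \<in> sets borel"
proof -
  obtain g where g: "g holomorphic_on (f ` S)" "\<And>z. z \<in> S \<Longrightarrow> g (f z) = z"
    using holomorphic_has_inverse[OF assms(1-3)] by metis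
  have op: "open (f ` S)" by (rule open_mapping_thm3[OF assms(1-3)])
  have "g \<in> borel_measurable (restrict_space borel (f ` S))"
    by (intro borel_measurable_continuous_on_restrict holomorphic_on_imp_continuous_on g(1))
  from measurable_sets[OF this A(1)] have "g -` A \<inter> f ` S \<in> sets borel"
    using op by (simp add: sets_restrict_space_iff space_restrict_space)
  moreover have "g -` A \<inter> f ` S = f ` A"
    using g(2) A(2) by (auto simp: image_iff)
  ultimately show ?thesis by simp
qed

text \<open>Area formula: read in real coordinates, the differential of \<open>f\<close> is
  multiplication by \<open>deriv f z\<close>, a rotation combined with a scaling, so its determinant
  is the square of the modulus.\<close>

lemma emeasure_holomorphic_image:
  fixes f :: "complex \<Rightarrow> complex"
  assumes hol: "f holomorphic_on S" and "open S" and inj: "inj_on f S"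
    and A: "A \<in> sets borel" "A \<subseteq> S"
  shows "emeasure lborel (f ` A) = (\<integral>\<^sup>+z. ennreal ((cmod (deriv f z))\<^sup>2) * indicator A z \<partial>lborel)"
proof -
  define T where "T = (\<lambda>v::real^2. Complex (vec_nth v 1) (vec_nth v 2))"
  define J where "J = (\<lambda>z. vector [Re z, Im z] :: real^2)"
  have TJ: "T (J z) = z" and JT: "J (T v) = v" for z v
    by (auto simp: T_def J_def vec_eq_iff forall_2)
  have T_bl: "bounded_linear T"
    unfolding T_def by (rule bounded_linearI'[OF]) (auto simp: complex_eq_iff)
  have J_bl: "bounded_linear J"
    unfolding J_def
    by (rule linear_conv_bounded_linear[THEN iffD1], rule linearI)
       (auto simp: vec_eq_iff forall_2)
  have T_meas[measurable]: "T \<in> borel_measurable borel"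
    by (intro borel_measurable_continuous_onI linear_continuous_on T_bl)
  have distrT: "distr lborel borel T = lborel"
    unfolding T_def by (rule distr_lborel_Complex)
  have A_S2: "T -` A \<in> sets borel"
    using measurable_sets_borel[OF T_meas A(1)] by simp
  have fA: "f ` A \<in> sets borel"
    by (rule borel_holomorphic_image[OF assms])
  define F where "F = J \<circ> f \<circ> T"
  define F' where "F' = (\<lambda>x v. J (deriv f (T x) * T v))"
  have derF: "(F has_derivative F' x) (at x within T -` A)" if "x \<in> T -` A" for x
  proof -
    have "(f has_field_derivative deriv f (T x)) (at (T x))"
      using that A holomorphic_derivI[OF hol \<open>open S\<close>] by blast
    then have "(f has_derivative (*) (deriv f (T x))) (at (T x))"
      by (simp add: has_field_derivative_def)
    from diff_chain_at[OF bounded_linear_imp_has_derivative[OF T_bl] this]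
    have "(f \<circ> T has_derivative (\<lambda>v. deriv f (T x) * T v)) (at x)" by (simp add: o_def)
    from diff_chain_at[OF this bounded_linear_imp_has_derivative[OF J_bl]]
    show ?thesis unfolding F_def F'_def
      by (simp add: o_def has_derivative_at_withinI)
  qed
  have injF: "inj_on F (T -` A)"
  proof (rule inj_onI)
    fix x y assume "x \<in> T -` A" "y \<in> T -` A" "F x = F y"
    then have "f (T x) = f (T y)" by (metis F_def TJ comp_apply)
    then have "T x = T y" using inj A \<open>x \<in> _\<close> \<open>y \<in> _\<close> by (auto dest: inj_onD)
    then show "x = y" by (metis JT)
  qed
  have imF: "F ` (T -` A) = T -` (f ` A)"
  proof (intro equalityI subsetI)
    fix x assume "x \<in> T -` f ` A"
    then obtain z where z: "z \<in> A" "T x = f z" by auto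
    then have "x = F (J z)" "J z \<in> T -` A" by (simp_all add: F_def TJ flip: z(2)) (simp add: JT)
    then show "x \<in> F ` (T -` A)" by blast
  qed (auto simp: F_def TJ)
  \<comment> \<open>Multiplication by \<open>p + \<i> q\<close> has the real matrix with rows
    \<open>(p, -q)\<close> and \<open>(q, p)\<close>, of determinant
    \<open>p\<^sup>2 + q\<^sup>2\<close>.\<close>
  have det: "\<bar>det (matrix (F' x))\<bar> = (cmod (deriv f (T x)))\<^sup>2" for x
    unfolding cmod_power2
    by (simp add: det_2 matrix_def F'_def J_def T_def axis_def power2_eq_square)
  \<comment> \<open>The Jacobian formula ties finite measure of the image to gauge integrability of
    the density. Read forwards, it settles images of finite measure; read backwards, it shows that
    an image of infinite measure forces an infinite integral.\<close>
  have key: "(F ` (T -` A) \<in> lmeasurable \<and> measure lebesgue (F ` (T -` A)) = r) \<longleftrightarrow>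
      ((\<lambda>x. (cmod (deriv f (T x)))\<^sup>2) has_integral r) (T -` A)" for r
    using has_measure_differentiable_image[OF _ derF injF, of r] A_S2
    by (simp add: det)
  have d_meas: "(\<lambda>z. (cmod (deriv f z))\<^sup>2 * indicator A z) \<in> borel_measurable borel"
  proof -
    have "continuous_on S (deriv f)"
      by (intro holomorphic_on_imp_continuous_on holomorphic_deriv hol \<open>open S\<close>)
    then have "(\<lambda>z. (cmod (deriv f z))\<^sup>2) \<in> borel_measurable (restrict_space borel S)"
      by (intro borel_measurable_continuous_on_restrict continuous_intros)
    then have "(\<lambda>z. (cmod (deriv f z))\<^sup>2 * indicator S z) \<in> borel_measurable borel"
      using \<open>open S\<close> by (simp add: borel_measurable_restrict_space_iff mult.commute)
    then have "(\<lambda>z. ((cmod (deriv f z))\<^sup>2 * indicator S z) * indicator A z) \<in> borel_measurable borel"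
      using A by measurable
    moreover have "((cmod (deriv f z))\<^sup>2 * indicator S z) * indicator A z = (cmod (deriv f z))\<^sup>2 * indicator A z" for z
      using A by (auto simp: indicator_def)
    ultimately show ?thesis by simp
  qed
  have e1: "emeasure lborel (f ` A) = emeasure lborel (T -` f ` A)"
    by (subst distrT[symmetric]) (simp add: emeasure_distr fA)
  have "(\<integral>\<^sup>+z. ennreal ((cmod (deriv f z))\<^sup>2) * indicator A z \<partial>lborel)
      = (\<integral>\<^sup>+z. ennreal ((cmod (deriv f z))\<^sup>2 * indicator A z) \<partial>lborel)"
    by (intro nn_integral_cong) (auto simp: indicator_def)
  also have "\<dots> = (\<integral>\<^sup>+x. ennreal ((cmod (deriv f (T x)))\<^sup>2 * indicator A (T x)) \<partial>lborel)"
    by (subst distrT[symmetric], subst nn_integral_distr) (use d_meas in auto)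
  finally have e2: "(\<integral>\<^sup>+z. ennreal ((cmod (deriv f z))\<^sup>2) * indicator A z \<partial>lborel) = \<dots>" .
  show ?thesis
  proof (cases "emeasure lborel (f ` A) = \<infinity>")
    case False
    then have "emeasure lebesgue (T -` f ` A) < \<infinity>"
      using e1 measurable_sets_borel[OF T_meas fA] by (simp add: emeasure_completion top.not_eq_extremum)
    then have "T -` f ` A \<in> lmeasurable"
      using measurable_sets_borel[OF T_meas fA] by (auto intro!: fmeasurableI)
    then have hi: "((\<lambda>x. (cmod (deriv f (T x)))\<^sup>2) has_integral measure lebesgue (T -` f ` A)) (T -` A)"
      using key[of "measure lebesgue (T -` f ` A)"] unfolding imF by blast
    have "(\<integral>\<^sup>+x. ennreal ((cmod (deriv f (T x)))\<^sup>2) * indicator (T -` A) x \<partial>lborel) = ennreal (measure lebesgue (T -` f ` A))"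
      by (rule nn_integral_has_integral_lebesgue'[OF _ hi]) simp
    also have "\<dots> = emeasure lborel (T -` f ` A)"
      using False e1 measurable_sets_borel[OF T_meas fA] by (simp add: emeasure_eq_ennreal_measure)
    also have "(\<integral>\<^sup>+x. ennreal ((cmod (deriv f (T x)))\<^sup>2) * indicator (T -` A) x \<partial>lborel)
       = (\<integral>\<^sup>+x. ennreal ((cmod (deriv f (T x)))\<^sup>2 * indicator A (T x)) \<partial>lborel)"
      by (intro nn_integral_cong) (auto simp: indicator_def)
    finally show ?thesis using e1 e2 by simp
  next
    case True
    have "(\<integral>\<^sup>+x. ennreal ((cmod (deriv f (T x)))\<^sup>2 * indicator A (T x)) \<partial>lborel) = \<infinity>"
    proof (rule ccontr)
      assume ne: "\<not> ?thesis"
      have m: "(\<lambda>x. (cmod (deriv f (T x)))\<^sup>2 * indicator A (T x)) \<in> borel_measurable borel"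
        using measurable_compose[OF T_meas d_meas] by simp
      have "(\<lambda>x. (cmod (deriv f (T x)))\<^sup>2 * indicator A (T x)) integrable_on UNIV"
        by (rule nn_integral_integrable_on[OF m]) (use ne in \<open>auto simp: top.not_eq_extremum\<close>)
      then have "(\<lambda>x. if x \<in> T -` A then (cmod (deriv f (T x)))\<^sup>2 else 0) integrable_on UNIV"
        by (rule integrable_eq) (simp add: indicator_def)
      then have "(\<lambda>x. (cmod (deriv f (T x)))\<^sup>2) integrable_on (T -` A)"
        by (simp only: integrable_restrict_UNIV)
      then have "T -` f ` A \<in> lmeasurable"
        using key imF by (auto simp: integrable_on_def)
      then have "emeasure lborel (T -` f ` A) < \<infinity>"
        using measurable_sets_borel[OF T_meas fA] by (auto simp: fmeasurable_def emeasure_completion)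
      then show False using True e1 by simp
    qed
    then show ?thesis using True e2 by simp
  qed
qed

lemma borel_measurable_restrict_lborel:
  "continuous_on S f \<Longrightarrow> f \<in> borel_measurable (restrict_space lborel S)"
  using borel_measurable_continuous_on_restrict[of S f]
  by (simp cong: measurable_cong_sets sets_restrict_space_cong)

text \<open>The area formula as an equality of measures: a Borel set \<open>B\<close> in the image
  is the image of its preimage. In this form the general rules for \<open>distr\<close> and
  \<open>density\<close> transform integrals.\<close>

lemma distr_density_holomorphic:
  fixes f :: "complex \<Rightarrow> complex"
  assumes hol: "f holomorphic_on S" and S: "open S" and inj: "inj_on f S"
  shows "distr (density (restrict_space lborel S) (\<lambda>z. ennreal ((cmod (deriv f z))\<^sup>2)))
     (restrict_space lborel (f ` S)) f = restrict_space lborel (f ` S)"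
    (is "distr ?D ?R f = ?R")
proof (rule measure_eqI)
  fix B assume "B \<in> sets (distr ?D ?R f)"
  have ofS: "open (f ` S)" by (rule open_mapping_thm3[OF hol S inj])
  have B: "B \<in> sets borel" "B \<subseteq> f ` S"
    using \<open>B \<in> _\<close> ofS by (auto simp: sets_restrict_space_iff)
  have f_meas: "f \<in> measurable ?D ?R"
    using borel_measurable_restrict_lborel[OF holomorphic_on_imp_continuous_on[OF hol]]
    by (auto intro!: measurable_restrict_space2 simp: space_restrict_space)
  have A: "f -` B \<inter> S \<in> sets borel"
    using measurable_sets[OF f_meas, of B] B ofS S
    by (simp add: sets_restrict_space_iff space_restrict_space)
  have d_meas: "(\<lambda>z. ennreal ((cmod (deriv f z))\<^sup>2)) \<in> borel_measurable (restrict_space lborel S)"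
  proof -
    have "continuous_on S (deriv f)"
      by (intro holomorphic_on_imp_continuous_on holomorphic_deriv hol S)
    then show ?thesis
      by (intro measurable_compose[OF _ measurable_ennreal] borel_measurable_restrict_lborel continuous_intros)
  qed
  have "emeasure (distr ?D ?R f) B = emeasure ?D (f -` B \<inter> S)"
    using f_meas B ofS by (simp add: emeasure_distr sets_restrict_space_iff space_restrict_space)
  also have "\<dots> = (\<integral>\<^sup>+z. ennreal ((cmod (deriv f z))\<^sup>2) * indicator (f -` B \<inter> S) z \<partial>restrict_space lborel S)"
    using A S d_meas by (subst emeasure_density) (auto simp: sets_restrict_space_iff)
  also have "\<dots> = (\<integral>\<^sup>+z. ennreal ((cmod (deriv f z))\<^sup>2) * indicator (f -` B \<inter> S) z \<partial>lborel)"
    using S by (subst nn_integral_restrict_space) (auto intro!: nn_integral_cong simp: indicator_def)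
  also have "\<dots> = emeasure lborel (f ` (f -` B \<inter> S))"
    using emeasure_holomorphic_image[OF hol S inj A] by simp
  also have "f ` (f -` B \<inter> S) = B"
    using B by auto
  also have "emeasure lborel B = emeasure ?R B"
    using B ofS by (simp add: emeasure_restrict_space)
  finally show "emeasure (distr ?D ?R f) B = emeasure ?R B" .
qed simp

text \<open>Integrability on the image is assumed because it supplies the measurability of
  \<open>h\<close> that \<open>integral_distr\<close> and \<open>integral_density\<close>
  require.\<close>

lemma change_of_variables_holomorphic_aux:
  fixes f :: "complex \<Rightarrow> complex" and h :: "complex \<Rightarrow> real"
  assumes hol: "f holomorphic_on S" and S: "open S" and inj: "inj_on f S"
    and h: "set_integrable lborel (f ` S) h"
  shows "set_integrable lborel S (\<lambda>z. (cmod (deriv f z))\<^sup>2 * h (f z))"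
    and "(LINT z:S|lborel. (cmod (deriv f z))\<^sup>2 * h (f z)) = (LINT w:f ` S|lborel. h w)"
proof -
  let ?d = "\<lambda>z. (cmod (deriv f z))\<^sup>2"
  let ?D = "density (restrict_space lborel S) (\<lambda>z. ennreal (?d z))"
  let ?R = "restrict_space lborel (f ` S)"
  have ofS: "open (f ` S)" by (rule open_mapping_thm3[OF hol S inj])
  have f_meas: "f \<in> measurable ?D ?R"
    using borel_measurable_restrict_lborel[OF holomorphic_on_imp_continuous_on[OF hol]]
    by (auto intro!: measurable_restrict_space2 simp: space_restrict_space)
  have d_meas: "?d \<in> borel_measurable (restrict_space lborel S)"
  proof -
    have "continuous_on S (deriv f)"
      by (intro holomorphic_on_imp_continuous_on holomorphic_deriv hol S)
    then show ?thesis
      by (intro borel_measurable_restrict_lborel continuous_intros)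
  qed
  have hR: "integrable ?R h"
    using h ofS by (simp add: set_integrable_def integrable_restrict_space)
  then have h_meas: "h \<in> borel_measurable ?R" by simp
  have hf_meas: "(\<lambda>z. h (f z)) \<in> borel_measurable (restrict_space lborel S)"
    using measurable_compose[OF f_meas h_meas] by simp
  have dist: "distr ?D ?R f = ?R" by (rule distr_density_holomorphic[OF hol S inj])
  have "integrable ?D (\<lambda>z. h (f z))"
    using hR integrable_distr_eq[OF f_meas h_meas] dist by simp
  then have "integrable (restrict_space lborel S) (\<lambda>z. ?d z *\<^sub>R h (f z))"
    using integrable_density[OF hf_meas d_meas] by simp
  then show "set_integrable lborel S (\<lambda>z. ?d z * h (f z))"
    using S by (simp add: set_integrable_def integrable_restrict_space)
  have "(LINT w:f ` S|lborel. h w) = integral\<^sup>L ?R h"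
    using ofS by (simp add: set_lebesgue_integral_def integral_restrict_space)
  also have "\<dots> = integral\<^sup>L ?D (\<lambda>z. h (f z))"
    using integral_distr[OF f_meas h_meas] dist by simp
  also have "\<dots> = integral\<^sup>L (restrict_space lborel S) (\<lambda>z. ?d z *\<^sub>R h (f z))"
    using integral_density[OF hf_meas d_meas] by simp
  also have "\<dots> = (LINT z:S|lborel. ?d z * h (f z))"
    using S by (simp add: set_lebesgue_integral_def integral_restrict_space)
  finally show "(LINT z:S|lborel. ?d z * h (f z)) = (LINT w:f ` S|lborel. h w)" ..
qed

text \<open>Integrability is pulled back along \<open>f\<close> and, for the converse, along its inverse; if it fails, both
  integrals have the junk value \<open>0\<close>.\<close>

lemma change_of_variables_holomorphic:
  fixes f :: "complex \<Rightarrow> complex" and h :: "complex \<Rightarrow> real"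
  assumes hol: "f holomorphic_on S" and S: "open S" and inj: "inj_on f S" and "U \<subseteq> S"
  shows set_integrable_holomorphic_image:
      "set_integrable lborel (f ` U) h \<longleftrightarrow> set_integrable lborel U (\<lambda>z. (cmod (deriv f z))\<^sup>2 * h (f z))"
    and set_integral_holomorphic_image:
      "(LINT w:f ` U|lborel. h w) = (LINT z:U|lborel. (cmod (deriv f z))\<^sup>2 * h (f z))"
proof -
  \<comment> \<open>\<open>U\<close> is an arbitrary subset of \<open>S\<close>. Truncating the
    integrand by an indicator moves the whole comparison to the open sets \<open>S\<close> and its
    image.\<close>
  let ?h = "\<lambda>w. indicator (f ` U) w * h w"
  let ?k = "\<lambda>z. (cmod (deriv f z))\<^sup>2 * ?h (f z)"
  obtain g where g: "g holomorphic_on (f ` S)"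
      "\<And>z. z \<in> S \<Longrightarrow> deriv f z * deriv g (f z) = 1" "\<And>z. z \<in> S \<Longrightarrow> g (f z) = z"
    using holomorphic_has_inverse[OF hol S inj] by blast
  have ofS: "open (f ` S)" by (rule open_mapping_thm3[OF hol S inj])
  have gfS: "g ` f ` S = S" and inj_g: "inj_on g (f ` S)"
    using g(3) by (force simp: image_iff, auto simp: inj_on_def)
  have ind: "f z \<in> f ` U \<longleftrightarrow> z \<in> U" if "z \<in> S" for z
    using inj that \<open>U \<subseteq> S\<close> by (auto dest: inj_onD)
  have image_eq: "indicator (f ` S) w *\<^sub>R ?h w = indicator (f ` U) w *\<^sub>R h w" for w
    using \<open>U \<subseteq> S\<close> by (auto simp: indicator_def)
  have dom_eq: "indicator S z *\<^sub>R ?k z = indicator U z *\<^sub>R ((cmod (deriv f z))\<^sup>2 * h (f z))" for z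
    using \<open>U \<subseteq> S\<close> ind by (cases "z \<in> S") (auto simp: indicator_def)
  \<comment> \<open>The Jacobians of \<open>f\<close> and of its inverse multiply to
    \<open>1\<close>, so pulling \<open>?k\<close> back along \<open>g\<close> returns the truncated
    integrand.\<close>
  have inv_eq: "indicator (f ` S) w *\<^sub>R ((cmod (deriv g w))\<^sup>2 * ?k (g w)) = indicator (f ` S) w *\<^sub>R ?h w" for w
  proof (cases "w \<in> f ` S")
    case True
    then obtain z where z: "z \<in> S" "w = f z" by blast
    have "(cmod (deriv g w))\<^sup>2 * (cmod (deriv f z))\<^sup>2 = (cmod (deriv f z * deriv g (f z)))\<^sup>2"
      by (simp add: z norm_mult power_mult_distrib)
    then show ?thesis using g(2,3) z by simp
  qed simp
  have iff: "set_integrable lborel (f ` S) ?h \<longleftrightarrow> set_integrable lborel S ?k"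
  proof
    assume "set_integrable lborel (f ` S) ?h"
    from change_of_variables_holomorphic_aux(1)[OF hol S inj this]
    show "set_integrable lborel S ?k" .
  next
    assume "set_integrable lborel S ?k"
    then have "set_integrable lborel (g ` f ` S) ?k" by (simp add: gfS)
    from change_of_variables_holomorphic_aux(1)[OF g(1) ofS inj_g this]
    show "set_integrable lborel (f ` S) ?h"
      unfolding set_integrable_def inv_eq .
  qed
  then show "set_integrable lborel (f ` U) h \<longleftrightarrow> set_integrable lborel U (\<lambda>z. (cmod (deriv f z))\<^sup>2 * h (f z))"
    unfolding set_integrable_def image_eq dom_eq .
  have "(LINT w:f ` S|lborel. ?h w) = (LINT z:S|lborel. ?k z)"
  proof (cases "set_integrable lborel (f ` S) ?h")
    case True
    show ?thesis using change_of_variables_holomorphic_aux(2)[OF hol S inj True] ..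
  next
    case False
    then show ?thesis
      using iff by (simp add: set_lebesgue_integral_def set_integrable_def not_integrable_integral_eq)
  qed
  then show "(LINT w:f ` U|lborel. h w) = (LINT z:U|lborel. (cmod (deriv f z))\<^sup>2 * h (f z))"
    unfolding set_lebesgue_integral_def image_eq dom_eq .
qed

subsection \<open>Smooth functions composed with holomorphic maps\<close>

text \<open>\<open>Ck\<close> relative to an open set, because a test function on the image can be composed with the
  conformal map only on its domain; the pullback is extended by \<open>0\<close>.\<close>

primrec Ck_on :: "complex set \<Rightarrow> nat \<Rightarrow> (complex \<Rightarrow> real) \<Rightarrow> bool" where
  "Ck_on S 0 f \<longleftrightarrow> continuous_on S f"
| "Ck_on S (Suc k) f \<longleftrightarrow> (\<forall>z\<in>S. f differentiable at z) \<and> (\<forall>v. Ck_on S k (partial_deriv v f))"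

lemma Ck_iff_Ck_on_UNIV: "Ck k f \<longleftrightarrow> Ck_on UNIV k f"
  by (induction k arbitrary: f) auto

lemma partial_deriv_eqI: "(f has_derivative f') (at z) \<Longrightarrow> partial_deriv v f z = f' v"
  unfolding partial_deriv_def by (metis frechet_derivative_at)

lemma partial_deriv_cong:
  assumes "open S" "z \<in> S" "\<And>w. w \<in> S \<Longrightarrow> f w = g w"
  shows "partial_deriv v f z = partial_deriv v g z"
proof -
  \<comment> \<open>Having the same derivatives at \<open>z\<close>, the two functions get the same
    choice inside \<open>frechet_derivative\<close>, even at points where no derivative
    exists.\<close>
  have "(f has_derivative D) (at z) \<longleftrightarrow> (g has_derivative D) (at z)" for D
    using assms has_derivative_transform_within_open[of f D z UNIV S g]
      has_derivative_transform_within_open[of g D z UNIV S f] by auto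
  then show ?thesis by (simp add: partial_deriv_def frechet_derivative_def)
qed

lemma differentiable_cong_open:
  fixes f g :: "complex \<Rightarrow> real"
  assumes "open S" "z \<in> S" "\<And>w. w \<in> S \<Longrightarrow> f w = g w"
  shows "f differentiable at z \<longleftrightarrow> g differentiable at z"
  using assms has_derivative_transform_within_open[of f _ z UNIV S g]
      has_derivative_transform_within_open[of g _ z UNIV S f]
  unfolding differentiable_def by metis

lemma Ck_on_cong:
  assumes "open S" "\<And>w. w \<in> S \<Longrightarrow> f w = g w"
  shows "Ck_on S k f \<longleftrightarrow> Ck_on S k g"
  using assms(2)
proof (induction k arbitrary: f g)
  case 0
  then show ?case by (simp cong: continuous_on_cong)
next
  case (Suc k)
  have "Ck_on S k (partial_deriv v f) \<longleftrightarrow> Ck_on S k (partial_deriv v g)" for v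
    by (intro Suc.IH partial_deriv_cong[OF assms(1)] Suc.prems)
  then show ?case
    using differentiable_cong_open[OF assms(1) _ Suc.prems] by simp
qed

text \<open>Smoothness is local. This serves to glue a pulled-back test function on \<open>S\<close>
  with zero off its compact support.\<close>

lemma Ck_on_Un:
  assumes "open S" "open T"
  shows "Ck_on (S \<union> T) k f \<longleftrightarrow> Ck_on S k f \<and> Ck_on T k f"
proof (induction k arbitrary: f)
  case 0
  then show ?case
    using assms by (auto intro: continuous_on_open_Un elim: continuous_on_subset)
qed auto

lemma Ck_on_Suc_imp: "Ck_on S (Suc k) f \<Longrightarrow> Ck_on S k f"
proof (induction k arbitrary: f)
  case 0
  then show ?case
    by (auto intro!: continuous_at_imp_continuous_on differentiable_imp_continuous_within)
qed auto

lemma partial_deriv_const: "partial_deriv v (\<lambda>_. c) z = 0"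
  by (rule partial_deriv_eqI) (rule has_derivative_const)

lemma Ck_on_const: "Ck_on S k (\<lambda>_. c)"
  by (induction k arbitrary: c) (simp_all add: partial_deriv_const[abs_def])

lemma has_derivative_frechet:
  "f differentiable at z \<Longrightarrow> (f has_derivative (\<lambda>v. partial_deriv v f z)) (at z)"
  unfolding partial_deriv_def using frechet_derivative_works by (metis eta_contract_eq)

lemma Ck_on_add:
  assumes "open S"
  shows "Ck_on S k f \<Longrightarrow> Ck_on S k g \<Longrightarrow> Ck_on S k (\<lambda>z. f z + g z)"
proof (induction k arbitrary: f g)
  case 0
  then show ?case by (auto intro: continuous_intros)
next
  case (Suc k)
  have "partial_deriv v (\<lambda>z. f z + g z) z = partial_deriv v f z + partial_deriv v g z" if "z \<in> S" for v z
    using Suc.prems that by (intro partial_deriv_eqI has_derivative_add has_derivative_frechet) auto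
  then have "Ck_on S k (partial_deriv v (\<lambda>z. f z + g z)) \<longleftrightarrow>
      Ck_on S k (\<lambda>z. partial_deriv v f z + partial_deriv v g z)" for v
    by (rule Ck_on_cong[OF assms])
  then show ?case using Suc by auto
qed

lemma Ck_on_mult:
  assumes "open S"
  shows "Ck_on S k f \<Longrightarrow> Ck_on S k g \<Longrightarrow> Ck_on S k (\<lambda>z. f z * g z)"
proof (induction k arbitrary: f g)
  case 0
  then show ?case by (auto intro: continuous_intros)
next
  case (Suc k)
  have "partial_deriv v (\<lambda>z. f z * g z) z = f z * partial_deriv v g z + partial_deriv v f z * g z" if "z \<in> S" for v z
    using Suc.prems that by (intro partial_deriv_eqI has_derivative_mult has_derivative_frechet) auto
  then have *: "Ck_on S k (partial_deriv v (\<lambda>z. f z * g z)) \<longleftrightarrow>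
      Ck_on S k (\<lambda>z. f z * partial_deriv v g z + partial_deriv v f z * g z)" for v
    by (rule Ck_on_cong[OF assms])
  have "Ck_on S k (\<lambda>z. f z * partial_deriv v g z + partial_deriv v f z * g z)" for v
    using Suc.prems Ck_on_Suc_imp[OF Suc.prems(1)] Ck_on_Suc_imp[OF Suc.prems(2)]
    by (intro Ck_on_add[OF assms] Suc.IH) auto
  then show ?case using Suc.prems * by auto
qed

lemma has_derivative_Re_mult_holomorphic:
  assumes "h holomorphic_on S" "open S" "z \<in> S"
  shows "((\<lambda>z. Re (h z)) has_derivative (\<lambda>v. Re (deriv h z * v))) (at z)"
  using holomorphic_derivI[OF assms]
  unfolding has_field_derivative_def by (rule has_derivative_Re)

text \<open>The induction closes because a directional derivative of \<open>Re h\<close> is the real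
  part of \<open>deriv h z * v\<close>, which is again holomorphic in \<open>z\<close>.\<close>

lemma Ck_on_Re_holomorphic:
  assumes "open S"
  shows "h holomorphic_on S \<Longrightarrow> Ck_on S k (\<lambda>z. Re (h z))"
proof (induction k arbitrary: h)
  case 0
  then show ?case by (auto intro!: continuous_intros holomorphic_on_imp_continuous_on)
next
  case (Suc k)
  note d = has_derivative_Re_mult_holomorphic[OF Suc.prems assms]
  have "Ck_on S k (partial_deriv v (\<lambda>z. Re (h z))) \<longleftrightarrow> Ck_on S k (\<lambda>z. Re (deriv h z * v))" for v
    by (intro Ck_on_cong[OF assms] partial_deriv_eqI[OF d])
  moreover have "Ck_on S k (\<lambda>z. Re (deriv h z * v))" for v
    by (intro Suc.IH holomorphic_intros holomorphic_deriv Suc.prems assms)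
  ultimately show ?case using d by (auto simp: differentiable_def)
qed

text \<open>Chain rule, with the outer differential expanded in the real basis \<open>1\<close>,
  \<open>\<i>\<close>. The imaginary part of \<open>w\<close> is written
  \<open>Re (- \<i> * w)\<close>, so that every coefficient is the real part of a holomorphic
  function.\<close>

lemma has_derivative_compose_holomorphic:
  fixes g :: "complex \<Rightarrow> real"
  assumes "f holomorphic_on S" "open S" "z \<in> S" "g differentiable at (f z)"
  shows "((\<lambda>z. g (f z)) has_derivative (\<lambda>v.
      Re (deriv f z * v) * partial_deriv 1 g (f z) + Re (- \<i> * (deriv f z * v)) * partial_deriv \<i> g (f z))) (at z)"
proof -
  let ?D = "\<lambda>v. partial_deriv v g (f z)"
  have g: "(g has_derivative ?D) (at (f z))" by (rule has_derivative_frechet[OF assms(4)])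
  then have lin: "linear ?D" by (rule has_derivative_linear)
  have D: "?D w = Re w * ?D 1 + Re (- \<i> * w) * ?D \<i>" for w
  proof -
    have "w = Re w *\<^sub>R 1 + Im w *\<^sub>R \<i>" by (simp add: complex_eq_iff)
    then have "?D w = ?D (Re w *\<^sub>R 1 + Im w *\<^sub>R \<i>)" by simp
    then show ?thesis
      by (simp only: linear_add[OF lin] linear_scale[OF lin]) simp
  qed
  have "(f has_derivative (*) (deriv f z)) (at z)"
    using holomorphic_derivI[OF assms(1-3)] by (simp add: has_field_derivative_def)
  from diff_chain_at[OF this g] show ?thesis
    by (simp only: o_def D[symmetric])
qed

text \<open>By the chain rule a partial derivative of the composition is a sum of products of smooth
  coefficients with partial derivatives of \<open>g\<close> composed with \<open>f\<close>; the
  induction hypothesis, being general in \<open>g\<close>, covers the latter.\<close>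

lemma Ck_on_compose_holomorphic:
  assumes "open S" "f holomorphic_on S"
  shows "Ck k g \<Longrightarrow> Ck_on S k (\<lambda>z. g (f z))"
proof (induction k arbitrary: g)
  case 0
  then show ?case
    using continuous_on_compose2[of UNIV g S f] holomorphic_on_imp_continuous_on[OF assms(2)] by auto
next
  case (Suc k)
  have d: "z \<in> S \<Longrightarrow> ((\<lambda>z. g (f z)) has_derivative (\<lambda>v.
      Re (deriv f z * v) * partial_deriv 1 g (f z) + Re (- \<i> * (deriv f z * v)) * partial_deriv \<i> g (f z))) (at z)" for z
    using Suc.prems by (intro has_derivative_compose_holomorphic[OF assms(2,1)]) auto
  have "Ck_on S k (partial_deriv v (\<lambda>z. g (f z))) \<longleftrightarrow> Ck_on S k (\<lambda>z. 
      Re (deriv f z * v) * partial_deriv 1 g (f z) + Re (- \<i> * (deriv f z * v)) * partial_deriv \<i> g (f z))" for v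
    by (intro Ck_on_cong[OF assms(1)] partial_deriv_eqI[OF d])
  moreover have "Ck_on S k (\<lambda>z. 
      Re (deriv f z * v) * partial_deriv 1 g (f z) + Re (- \<i> * (deriv f z * v)) * partial_deriv \<i> g (f z))" for v
    using Suc.prems
    by (intro Ck_on_add Ck_on_mult Ck_on_Re_holomorphic Suc.IH holomorphic_intros holomorphic_deriv assms) auto
  ultimately show ?case using d by (auto simp: differentiable_def)
qed

text \<open>By the Cauchy-Riemann equations the first-order terms cancel, because \<open>Re \<circ> f\<close> and \<open>Im \<circ> f\<close>
  are harmonic; the mixed second-order terms cancel in pairs.\<close>

lemma laplacian_compose_holomorphic:
  assumes "open S" "f holomorphic_on S" "Ck 2 g" "z \<in> S"
  shows "laplacian (\<lambda>z. g (f z)) z = (cmod (deriv f z))\<^sup>2 * laplacian g (f z)"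
proof -
  define gx where "gx = partial_deriv 1 g"
  define gy where "gy = partial_deriv \<i> g"
  have diff: "g differentiable at w" "gx differentiable at w" "gy differentiable at w" for w
    using assms(3) by (auto simp: gx_def gy_def numeral_2_eq_2)
  define D where "D = (\<lambda>h w v. Re (deriv f w * v) * partial_deriv 1 h (f w) + Re (- \<i> * (deriv f w * v)) * partial_deriv \<i> h (f w))"
  have dD: "((\<lambda>z. h (f z)) has_derivative D h w) (at w)" if "w \<in> S" "h differentiable at (f w)" for h w
    unfolding D_def by (rule has_derivative_compose_holomorphic[OF assms(2,1) that])
  have pd: "partial_deriv v (partial_deriv v (\<lambda>z. g (f z))) z =
      Re (deriv f z * v) * D gx z v + Re (deriv (deriv f) z * v * v) * gx (f z) +
      (Re (- \<i> * (deriv f z * v)) * D gy z v + Re (- \<i> * (deriv (deriv f) z * v * v)) * gy (f z))" for v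
  proof -
    have "partial_deriv v (partial_deriv v (\<lambda>z. g (f z))) z =
       partial_deriv v (\<lambda>w. Re (deriv f w * v) * gx (f w) + Re (- \<i> * (deriv f w * v)) * gy (f w)) z"
      by (rule partial_deriv_cong[OF assms(1,4)])
        (simp only: partial_deriv_eqI[OF dD] diff D_def gx_def gy_def)
    also have "\<dots> = Re (deriv f z * v) * D gx z v + Re (deriv (deriv f) z * v * v) * gx (f z) +
      (Re (- \<i> * (deriv f z * v)) * D gy z v + Re (- \<i> * (deriv (deriv f) z * v * v)) * gy (f z))"
    \<comment> \<open>The derivative is a function of the increment \<open>u\<close> while the first
      direction \<open>v\<close> stays frozen; the claim is its value at
      \<open>u = v\<close>.\<close>
    proof (rule partial_deriv_eqI[where f' = "\<lambda>u. Re (deriv f z * v) * D gx z u + Re (deriv (deriv f) z * v * u) * gx (f z) +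
      (Re (- \<i> * (deriv f z * v)) * D gy z u + Re (- \<i> * (deriv (deriv f) z * v * u)) * gy (f z))"])
      have "(deriv f has_derivative (*) (deriv (deriv f) z)) (at z)"
        using holomorphic_derivI[OF holomorphic_deriv[OF assms(2,1)] assms(1,4)]
        by (simp add: has_field_derivative_def)
      then have "((\<lambda>w. deriv f w * v) has_derivative (\<lambda>u. deriv (deriv f) z * v * u)) (at z)"
        by (auto intro!: derivative_eq_intros)
      then show "((\<lambda>w. Re (deriv f w * v) * gx (f w) + Re (- \<i> * (deriv f w * v)) * gy (f w)) has_derivative
         (\<lambda>u. Re (deriv f z * v) * D gx z u + Re (deriv (deriv f) z * v * u) * gx (f z) +
      (Re (- \<i> * (deriv f z * v)) * D gy z u + Re (- \<i> * (deriv (deriv f) z * v * u)) * gy (f z)))) (at z)"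
        by (intro has_derivative_add has_derivative_mult has_derivative_Re has_derivative_mult_right dD assms(4) diff)
    qed
    finally show ?thesis .
  qed
  show ?thesis
    unfolding laplacian_def pd cmod_power2 D_def gx_def gy_def
    by (simp add: algebra_simps power2_eq_square)
qed

subsection \<open>Conformal covariance\<close>

text \<open>The support of \<open>\<psi>\<close> is a compact part of the image of \<open>U\<close>,
  so the inverse carries it to a compact \<open>K\<close> inside \<open>U\<close>. The pullback is
  smooth on \<open>S\<close> and zero on the complement of \<open>K\<close>; these open sets cover
  the plane, so extension by zero creates no singularity at the boundary of
  \<open>S\<close>.\<close>

lemma test_function_compose_holomorphic:
  assumes hol: "f holomorphic_on S" and S: "open S" and inj: "inj_on f S" and U: "U \<subseteq> S"
    and \<psi>: "test_function (f ` U) \<psi>"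
  shows "test_function U (\<lambda>z. if z \<in> S then \<psi> (f z) else 0)"
proof -
  let ?\<theta> = "\<lambda>z. if z \<in> S then \<psi> (f z) else 0"
  obtain g where g: "g holomorphic_on (f ` S)" "\<And>z. z \<in> S \<Longrightarrow> g (f z) = z"
    using holomorphic_has_inverse[OF hol S inj] by metis
  define K where "K = g ` closure {w. \<psi> w \<noteq> 0}"
  have supp: "compact (closure {w. \<psi> w \<noteq> 0})" "closure {w. \<psi> w \<noteq> 0} \<subseteq> f ` U"
    using \<psi> by (auto simp: test_function_def)
  have "continuous_on (closure {w. \<psi> w \<noteq> 0}) g"
    by (rule continuous_on_subset[OF holomorphic_on_imp_continuous_on[OF g(1)]]) (use supp(2) U in auto)
  then have "compact K"
    unfolding K_def using supp(1) by (rule compact_continuous_image)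
  have "K \<subseteq> U"
    unfolding K_def using supp(2) U g(2) by (force simp: image_iff)
  have in_K: "z \<in> K" if "?\<theta> z \<noteq> 0" for z
    using that g(2)[of z] closure_subset[of "{w. \<psi> w \<noteq> 0}"] unfolding K_def
    by (auto simp: image_iff split: if_splits intro!: bexI[of _ "f z"])
  then have cl: "closure {z. ?\<theta> z \<noteq> 0} \<subseteq> K"
    using \<open>compact K\<close> by (intro closure_minimal compact_imp_closed) auto
  have "Ck k ?\<theta>" for k
  proof -
    have "Ck_on S k (\<lambda>z. \<psi> (f z))"
      using \<psi> by (intro Ck_on_compose_holomorphic[OF S hol]) (auto simp: test_function_def)
    then have 1: "Ck_on S k ?\<theta>"
      by (subst Ck_on_cong[OF S, of _ "\<lambda>z. \<psi> (f z)"]) auto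
    have op: "open (- K)" using \<open>compact K\<close> by (simp add: compact_imp_closed open_Compl)
    have "?\<theta> w = 0" if "w \<in> - K" for w using in_K[of w] that by blast
    then have 2: "Ck_on (- K) k ?\<theta>"
      using Ck_on_cong[OF op, where f = ?\<theta> and g = "\<lambda>_. 0" and k = k] Ck_on_const by simp
    have "S \<union> - K = UNIV" using \<open>K \<subseteq> U\<close> U by auto
    then show ?thesis
      using 1 2 Ck_on_Un[OF S op, of k ?\<theta>] by (simp add: Ck_iff_Ck_on_UNIV)
  qed
  moreover have "compact (closure {z. ?\<theta> z \<noteq> 0})"
    using compact_Int_closed[OF \<open>compact K\<close> closed_closure] cl by (metis Int_absorb1)
  ultimately show ?thesis
    unfolding test_function_def by (intro conjI allI order_trans[OF cl \<open>K \<subseteq> U\<close>])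
qed

section \<open>Massive Green function and drift under a conformal map\<close>

text \<open>\<open>S\<close> is the original domain, on which \<open>f\<close> is holomorphic and
  injective; \<open>U\<close> is the slit domain at one time, over which the integrals run. The mass
  relation carries the Jacobian of \<open>f\<close>, so it can be substituted directly into a
  transformed integrand.\<close>

locale conformal_transport =
  fixes S U :: "complex set" and f :: "complex \<Rightarrow> complex" and \<mu> \<mu>' :: "complex \<Rightarrow> real"
  assumes hol: "f holomorphic_on S" and open_S: "open S" and inj: "inj_on f S" and U_subset: "U \<subseteq> S"
    and mass: "z \<in> U \<Longrightarrow> (cmod (deriv f z))\<^sup>2 * (\<mu>' (f z))\<^sup>2 = (\<mu> z)\<^sup>2"
begin

abbreviation g :: "complex \<Rightarrow> complex" where "g \<equiv> inv_into S f"

abbreviation pushforward :: "(complex \<Rightarrow> complex \<Rightarrow> real) \<Rightarrow> complex \<Rightarrow> complex \<Rightarrow> real" where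
  "pushforward G \<equiv> \<lambda>z w. G (g z) (g w)"

lemma g_f: "z \<in> U \<Longrightarrow> g (f z) = z"
  using U_subset inj by (auto intro: inv_into_f_f)

lemma g_f_S: "z \<in> S \<Longrightarrow> g (f z) = z"
  using inj by (auto intro: inv_into_f_f)

lemma continuous_on_g: "continuous_on (f ` S) g"
proof -
  obtain h where h: "h holomorphic_on (f ` S)" "\<And>z. z \<in> S \<Longrightarrow> h (f z) = z"
    using holomorphic_has_inverse[OF hol open_S inj] by metis
  have "h w = g w" if "w \<in> f ` S" for w using that h(2) g_f_S by auto
  then show ?thesis
    using holomorphic_on_imp_continuous_on[OF h(1)] by (simp cong: continuous_on_cong)
qed

text \<open>The subset \<open>V\<close> is either \<open>U\<close> itself or, for local
  integrability of the Green function, a compact part of it.\<close>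

lemma set_integrable_image_cong:
  assumes "V \<subseteq> U" "\<And>z. z \<in> V \<Longrightarrow> (cmod (deriv f z))\<^sup>2 * h' (f z) = h z"
  shows "set_integrable lborel (f ` V) h' \<longleftrightarrow> set_integrable lborel V h"
proof -
  have "set_integrable lborel V (\<lambda>z. (cmod (deriv f z))\<^sup>2 * h' (f z)) \<longleftrightarrow> set_integrable lborel V h"
    using assms(2) by (intro set_integrable_cong) auto
  then show ?thesis
    using set_integrable_holomorphic_image[OF hol open_S inj, of V h'] assms(1) U_subset by auto
qed

lemma set_integral_image_cong:
  assumes "\<And>z. z \<in> U \<Longrightarrow> (cmod (deriv f z))\<^sup>2 * h' (f z) = h z"
  shows "(LINT w:f ` U|lborel. h' w) = (LINT z:U|lborel. h z)"
proof -
  have "(LINT z:U|lborel. (cmod (deriv f z))\<^sup>2 * h' (f z)) = (LINT z:U|lborel. h z)"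
    unfolding set_lebesgue_integral_def using assms
    by (intro Bochner_Integration.integral_cong) (auto simp: indicator_def)
  then show ?thesis
    using set_integral_holomorphic_image[OF hol open_S inj U_subset, of h'] by simp
qed

lemma massive_green_pushforward:
  assumes G: "massive_green U \<mu> G"
  shows "massive_green (f ` U) \<mu>' (pushforward G)"
  unfolding massive_green_def
proof (intro ballI)
  fix w0 assume "w0 \<in> f ` U"
  then obtain z0 where z0: "z0 \<in> U" "w0 = f z0" by blast
  have g0: "g w0 = z0" using z0 g_f by simp
  have G0: "continuous_on (U - {z0}) (G z0)"
     "\<And>C. compact C \<Longrightarrow> C \<subseteq> U \<Longrightarrow> set_integrable lborel C (G z0)"
     "\<And>\<psi>. test_function U \<psi> \<Longrightarrow> (LINT w:U|lborel. G z0 w * (- laplacian \<psi> w + (\<mu> w)\<^sup>2 * \<psi> w)) = \<psi> z0"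
     "\<And>\<epsilon>. \<epsilon> > 0 \<Longrightarrow> \<exists>C. compact C \<and> C \<subseteq> U \<and> (\<forall>w\<in>U - C. \<bar>G z0 w\<bar> < \<epsilon>)"
    using G z0(1) unfolding massive_green_def by blast+
  have cont_G: "continuous_on (f ` U - {w0}) (\<lambda>w. G (g w0) (g w))"
    unfolding g0
  proof (rule continuous_on_compose2[OF G0(1)])
    show "continuous_on (f ` U - {w0}) g"
      using U_subset by (intro continuous_on_subset[OF continuous_on_g]) auto
    show "g ` (f ` U - {w0}) \<subseteq> U - {z0}" using g_f z0 by auto
  qed
  have loc_int: "set_integrable lborel C (\<lambda>w. G (g w0) (g w))" if C: "compact C" "C \<subseteq> f ` U" for C
  proof -
    let ?C = "g ` C"
    have "compact ?C"
      using C U_subset by (intro compact_continuous_image continuous_on_subset[OF continuous_on_g]) auto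
    have "?C \<subseteq> U" using C g_f by auto
    have fC: "f ` ?C = C" using C g_f by (force simp: image_iff)
    let ?d = "\<lambda>z. (cmod (deriv f z))\<^sup>2"
    \<comment> \<open>Changing variables puts the Jacobian in front of \<open>G z0\<close>. It is
      continuous, hence bounded on the compact set \<open>?C\<close>, and local integrability of
      \<open>G z0\<close> gives a dominating function.\<close>
    have cont: "continuous_on ?C ?d"
      using \<open>?C \<subseteq> U\<close> U_subset
      by (intro continuous_intros continuous_on_subset[OF holomorphic_on_imp_continuous_on[OF holomorphic_deriv[OF hol open_S]]]) auto
    from compact_imp_bounded[OF compact_continuous_image[OF this \<open>compact ?C\<close>]]
    obtain b where b: "\<And>z. z \<in> ?C \<Longrightarrow> \<bar>?d z\<bar> \<le> b"
      unfolding bounded_iff by auto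
    have int: "set_integrable lborel ?C (G z0)" using G0(2) \<open>compact ?C\<close> \<open>?C \<subseteq> U\<close> by blast
    have C_borel: "?C \<in> sets borel" using \<open>compact ?C\<close> by (simp add: borel_compact)
    have "set_integrable lborel ?C (\<lambda>z. ?d z * G z0 z)"
    proof (rule set_integrable_bound)
      show "set_integrable lborel ?C (\<lambda>z. b * G z0 z)" using int by simp
      have "(\<lambda>z. indicator ?C z *\<^sub>R ?d z) \<in> borel_measurable borel"
        by (rule borel_measurable_continuous_on_indicator[OF C_borel cont])
      moreover have "(\<lambda>z. indicator ?C z *\<^sub>R G z0 z) \<in> borel_measurable borel"
        using int by (simp add: set_integrable_def borel_measurable_integrable)
      ultimately have "(\<lambda>z. (indicator ?C z *\<^sub>R ?d z) * (indicator ?C z *\<^sub>R G z0 z)) \<in> borel_measurable borel"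
        by (rule borel_measurable_times)
      then show "set_borel_measurable lborel ?C (\<lambda>z. ?d z * G z0 z)"
        \<comment> \<open>The product of the two truncated factors is the truncated product, as the
          indicator is idempotent.\<close>
        unfolding set_borel_measurable_def by (rule back_subst) (auto simp: indicator_def fun_eq_iff intro!: arg_cong[where f = "\<lambda>h. h \<in> _"])
      show "AE z in lborel. z \<in> ?C \<longrightarrow> norm (?d z * G z0 z) \<le> norm (b * G z0 z)"
      proof (intro always_eventually allI impI)
        fix z assume "z \<in> ?C"
        then have "\<bar>?d z\<bar> \<le> \<bar>b\<bar>" using b by (meson abs_ge_self order_trans)
        then show "norm (?d z * G z0 z) \<le> norm (b * G z0 z)"
          unfolding real_norm_def abs_mult by (intro mult_right_mono abs_ge_zero)
      qed
    qed
    moreover have "set_integrable lborel (f ` ?C) (\<lambda>w. G (g w0) (g w)) \<longleftrightarrow> set_integrable lborel ?C (\<lambda>z. ?d z * G z0 z)"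
      using \<open>?C \<subseteq> U\<close> by (intro set_integrable_image_cong) (auto simp: g0 g_f subset_iff)
    ultimately show ?thesis unfolding fC by blast
  qed
  have distr_eq: "(LINT w:f ` U|lborel. G (g w0) (g w) * (- laplacian \<psi> w + (\<mu>' w)\<^sup>2 * \<psi> w)) = \<psi> w0"
    if \<psi>: "test_function (f ` U) \<psi>" for \<psi>
  proof -
    \<comment> \<open>The defining identity of \<open>G\<close> is tested against the pullback of
      \<open>\<psi>\<close>, extended by zero.\<close>
    let ?\<theta> = "\<lambda>z. if z \<in> S then \<psi> (f z) else 0"
    have lap: "laplacian ?\<theta> z = (cmod (deriv f z))\<^sup>2 * laplacian \<psi> (f z)" if "z \<in> S" for z
    proof -
      have 1: "partial_deriv v ?\<theta> w = partial_deriv v (\<lambda>z. \<psi> (f z)) w" if "w \<in> S" for v w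
        using that by (intro partial_deriv_cong[OF open_S]) auto
      have "laplacian ?\<theta> z = laplacian (\<lambda>z. \<psi> (f z)) z"
        unfolding laplacian_def using that by (intro arg_cong2[where f = "(+)"] partial_deriv_cong[OF open_S] 1)
      also have "\<dots> = (cmod (deriv f z))\<^sup>2 * laplacian \<psi> (f z)"
        using \<psi> that by (intro laplacian_compose_holomorphic[OF open_S hol]) (auto simp: test_function_def)
      finally show ?thesis .
    qed
    have "(LINT w:f ` U|lborel. G (g w0) (g w) * (- laplacian \<psi> w + (\<mu>' w)\<^sup>2 * \<psi> w))
      = (LINT z:U|lborel. G z0 z * (- laplacian ?\<theta> z + (\<mu> z)\<^sup>2 * ?\<theta> z))"
    \<comment> \<open>The Jacobian is distributed over both terms: it turns the Laplacian of
      \<open>\<psi>\<close> into that of \<open>?\<theta>\<close>, and by \<open>mass\<close> the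
      squared mass on the image into the one on \<open>U\<close>.\<close>
    proof (rule set_integral_image_cong)
      fix z assume z: "z \<in> U"
      then have "z \<in> S" using U_subset by auto
      then show "(cmod (deriv f z))\<^sup>2 * (G (g w0) (g (f z)) * (- laplacian \<psi> (f z) + (\<mu>' (f z))\<^sup>2 * \<psi> (f z)))
        = G z0 z * (- laplacian ?\<theta> z + (\<mu> z)\<^sup>2 * ?\<theta> z)"
        unfolding g_f[OF z] g0 if_P[OF \<open>z \<in> S\<close>] lap[OF \<open>z \<in> S\<close>] mass[OF z, symmetric]
        by (simp only: algebra_simps)
    qed
    also have "\<dots> = ?\<theta> z0"
      by (rule G0(3)) (rule test_function_compose_holomorphic[OF hol open_S inj U_subset \<psi>])
    finally show ?thesis using z0 U_subset by auto
  qed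
  \<comment> \<open>Decay off compact subsets refers only to the topology of \<open>U\<close>, so
    the homeomorphism \<open>f\<close> preserves it, also when the image is unbounded.\<close>
  have boundary: "\<exists>C. compact C \<and> C \<subseteq> f ` U \<and> (\<forall>w\<in>f ` U - C. \<bar>G (g w0) (g w)\<bar> < \<epsilon>)" if "\<epsilon> > 0" for \<epsilon>
  proof -
    obtain C where C: "compact C" "C \<subseteq> U" "\<And>w. w \<in> U - C \<Longrightarrow> \<bar>G z0 w\<bar> < \<epsilon>"
      using G0(4)[OF \<open>\<epsilon> > 0\<close>] by blast
    have "compact (f ` C)"
      using C U_subset by (intro compact_continuous_image continuous_on_subset[OF holomorphic_on_imp_continuous_on[OF hol]]) auto
    then show ?thesis
      using C(2) unfolding g0 by (intro exI[of _ "f ` C"]) (auto simp: g_f intro!: C(3))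
  qed
  show "continuous_on (f ` U - {w0}) (pushforward G w0) \<and>
     (\<forall>C. compact C \<and> C \<subseteq> f ` U \<longrightarrow> set_integrable lborel C (pushforward G w0)) \<and>
     (\<forall>\<psi>. test_function (f ` U) \<psi> \<longrightarrow>
        (LINT w:f ` U|lborel. pushforward G w0 w * (- laplacian \<psi> w + (\<mu>' w)\<^sup>2 * \<psi> w)) = \<psi> w0) \<and>
     (\<forall>\<epsilon>>0. \<exists>C. compact C \<and> C \<subseteq> f ` U \<and> (\<forall>w\<in>f ` U - C. \<bar>pushforward G w0 w\<bar> < \<epsilon>))"
    by (intro conjI allI impI cont_G distr_eq boundary) (elim conjE, rule loc_int)
qed

text \<open>\<open>F\<close> and \<open>F'\<close> stand for the centered maps of the two slit
  domains. The Poisson kernel at the tip and the harmonic height see a point only through its image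
  in the half-plane, so they are invariant without any derivative factor.\<close>

context
  fixes F F' :: "complex \<Rightarrow> complex"
  assumes F': "z \<in> U \<Longrightarrow> F' (f z) = F z"
begin

text \<open>Kept pointwise so that it yields both the equality of the integrals and the equivalence
  of their integrability.\<close>

lemma poisson_integrand_image:
  assumes "z \<in> U" "w \<in> U"
  shows "(cmod (deriv f w))\<^sup>2 * ((\<mu>' (f w))\<^sup>2 * poisson_tip F' (f w) * pushforward G (f z) (f w))
    = (\<mu> w)\<^sup>2 * poisson_tip F w * G z w"
  unfolding poisson_tip_def F'[OF assms(2)] g_f[OF assms(1)] g_f[OF assms(2)] mass[OF assms(2), symmetric]
  by (simp only: mult.assoc)

lemma massive_poisson_tip_image:
  assumes "z \<in> U"
  shows "massive_poisson_tip (f ` U) F' \<mu>' (pushforward G) (f z) = massive_poisson_tip U F \<mu> G z"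
proof -
  have "(LINT w:f ` U|lborel. (\<mu>' w)\<^sup>2 * poisson_tip F' w * pushforward G (f z) w)
      = (LINT w:U|lborel. (\<mu> w)\<^sup>2 * poisson_tip F w * G z w)"
    by (rule set_integral_image_cong) (rule poisson_integrand_image[where G = G, OF assms])
  moreover have "poisson_tip F' (f z) = poisson_tip F z"
    using assms by (simp add: poisson_tip_def F')
  ultimately show ?thesis
    by (simp only: massive_poisson_tip_def)
qed

lemma drift_integrand_image:
  assumes "w \<in> U"
  shows "(cmod (deriv f w))\<^sup>2 * ((\<mu>' (f w))\<^sup>2 * massive_poisson_tip (f ` U) F' \<mu>' (pushforward G) (f w)
      * harmonic_height F' (f w))
    = (\<mu> w)\<^sup>2 * massive_poisson_tip U F \<mu> G w * harmonic_height F w"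
  unfolding massive_poisson_tip_image[OF assms] harmonic_height_def F'[OF assms] mass[OF assms, symmetric]
  by (simp only: mult.assoc)

lemma drift_integral_image:
  "drift_integral (f ` U) F' \<mu>' (pushforward G) = drift_integral U F \<mu> G"
  unfolding drift_integral_def by (rule set_integral_image_cong) (rule drift_integrand_image[where G = G])

lemma drift_integrable_image:
  "drift_integrable (f ` U) F' \<mu>' (pushforward G) \<longleftrightarrow> drift_integrable U F \<mu> G"
proof -
  have "set_integrable lborel (f ` U) (\<lambda>w. (\<mu>' w)\<^sup>2 * poisson_tip F' w * pushforward G (f z) w) \<longleftrightarrow>
      set_integrable lborel U (\<lambda>w. (\<mu> w)\<^sup>2 * poisson_tip F w * G z w)" if "z \<in> U" for z
    by (rule set_integrable_image_cong[OF order_refl]) (rule poisson_integrand_image[where G = G, OF that])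
  moreover have "set_integrable lborel (f ` U)
        (\<lambda>w. (\<mu>' w)\<^sup>2 * massive_poisson_tip (f ` U) F' \<mu>' (pushforward G) w * harmonic_height F' w) \<longleftrightarrow>
      set_integrable lborel U (\<lambda>w. (\<mu> w)\<^sup>2 * massive_poisson_tip U F \<mu> G w * harmonic_height F w)"
    by (rule set_integrable_image_cong[OF order_refl]) (rule drift_integrand_image[where G = G])
  ultimately show ?thesis
    unfolding drift_integrable_def by simp
qed

end

end

section \<open>From single paths to the law of the curve\<close>

text \<open>The transport is deterministic, path by path; the law adds only measurability and an
  almost-sure quantifier.\<close>

lemma massive_loewner_path_conformal_image:
  assumes hol: "f holomorphic_on D" and "open D" and inj: "inj_on f D"
    and mass: "\<And>z. z \<in> D \<Longrightarrow> (cmod (deriv f z))\<^sup>2 * (\<mu>' (f z))\<^sup>2 = (\<mu> z)\<^sup>2"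
    and c: "c ` {0<..<1} \<subseteq> D"
    and path: "massive_loewner_path D \<mu> \<phi> c W B G"
  shows "massive_loewner_path (f ` D) \<mu>' (\<phi> \<circ> inv_into D f) (\<lambda>s. f (c s)) W B
    (\<lambda>t z w. G t (inv_into D f z) (inv_into D f w))"
proof -
  have inv: "inv_into D f (f z) = z" if "z \<in> D" for z
    using inj that by simp
  let ?U = "slit_domain D \<phi> W"
  have U: "?U t \<subseteq> D" for t by (auto simp: slit_domain_def)
  have slit: "slit_domain (f ` D) (\<phi> \<circ> inv_into D f) W t = f ` ?U t" for t
    by (auto simp: slit_domain_def inv)
  interpret tr: conformal_transport D "?U t" f \<mu> \<mu>' for t
    using hol \<open>open D\<close> inj mass U by unfold_locales (auto simp: subset_iff)
  have F': "z \<in> ?U t \<Longrightarrow> centered_map (\<phi> \<circ> inv_into D f) W t (f z) = centered_map \<phi> W t z" for z t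
    by (simp add: centered_map_def inv slit_domain_def)
  have curve: "loewner_curve W (\<lambda>s. (\<phi> \<circ> inv_into D f) (f (c s)))"
  proof -
    \<comment> \<open>Restricted to parameters in \<open>{0<..<1}\<close>, where \<open>c s\<close>
      lies in \<open>D\<close> and the inverse cancels \<open>f\<close>.
      \<open>loewner_curve\<close> looks at these parameters only.\<close>
    have eq: "(\<phi> \<circ> inv_into D f) (f (c s)) = \<phi> (c s)" if "s \<in> {0<..<1}" for s
      using inv[of "c s"] c that by (simp add: image_subset_iff)
    have "loewner_curve W (\<lambda>s. \<phi> (c s))"
      using path by (simp add: massive_loewner_path_def Let_def)
    then show ?thesis
      unfolding loewner_curve_def using eq by simp
  qed
  have drift: "drift_integral (f ` ?U t) (centered_map (\<phi> \<circ> inv_into D f) W t) \<mu>' (tr.pushforward (G t))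
      = drift_integral (?U t) (centered_map \<phi> W t) \<mu> (G t)" for t
    by (rule tr.drift_integral_image) (rule F')
  have integrable: "drift_integrable (f ` ?U t) (centered_map (\<phi> \<circ> inv_into D f) W t) \<mu>' (tr.pushforward (G t))
      \<longleftrightarrow> drift_integrable (?U t) (centered_map \<phi> W t) \<mu> (G t)" for t
    by (rule tr.drift_integrable_image) (rule F')
  have green: "massive_green (f ` ?U t) \<mu>' (tr.pushforward (G t))" if "t \<ge> 0" for t
    using path that by (intro tr.massive_green_pushforward) (simp add: massive_loewner_path_def Let_def)
  show ?thesis
    \<comment> \<open>The rewrites hold at every time, so the integral equation and the clause for
      almost every time become those of \<open>path\<close>.\<close>
    using path unfolding massive_loewner_path_def Let_def slit drift integrable
    by (elim conjE, intro conjI allI impI green curve) (assumption | blast)+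
qed

text \<open>The filter lies below the region of index \<open>1\<close>, a subset of
  \<open>D\<close>. Identities valid only on \<open>D\<close> therefore hold eventually along a
  prime end.\<close>

lemma prime_end_le_principal:
  assumes "prime_end D x"
  shows "x \<le> principal D"
proof -
  obtain C where C: "x = (INF n\<in>{1..}. principal (chain_region D C n))"
    using assms by (auto simp: prime_end_def)
  have "chain_region D C 1 \<subseteq> D"
    unfolding chain_region_def by (auto dest!: connected_component_in)
  then have "principal (chain_region D C 1) \<le> principal D" by simp
  moreover have "x \<le> principal (chain_region D C 1)"
    unfolding C by (rule INF_lower) simp
  ultimately show ?thesis by (rule order_trans[rotated])
qed

theorem lemma6p2:
  fixes \<Omega> \<Omega>' :: "complex set"
    and a b a' b' :: "complex filter"
    and \<phi> :: "complex \<Rightarrow> complex"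
    and m m' :: "complex \<Rightarrow> real"
    and M :: "'w measure"
    and \<gamma> :: "'w \<Rightarrow> real \<Rightarrow> complex"
  assumes "\<Omega> \<noteq> {}" "open \<Omega>" "bounded \<Omega>" "simply_connected \<Omega>"
    and "prime_end \<Omega> a" "prime_end \<Omega> b" "a \<noteq> b"
    and "prime_end \<Omega>' a'" "prime_end \<Omega>' b'"
    and "conformal_map \<Omega> \<Omega>' \<phi>" "filtermap \<phi> a = a'" "filtermap \<phi> b = b'"
    and "\<forall>z\<in>\<Omega>. 0 \<le> m z" "bounded (m ` \<Omega>)" "continuous_on \<Omega> m"
    and "\<forall>w\<in>\<Omega>'. 0 \<le> m' w \<and>
           (m' w)\<^sup>2 = (cmod (deriv (inv_into \<Omega> \<phi>) w))\<^sup>2 * (m (inv_into \<Omega> \<phi> w))\<^sup>2"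
    and "has_massive_SLE4_law M \<gamma> \<Omega> a b m"
  shows "has_massive_SLE4_law M (\<lambda>\<omega> s. \<phi> (\<gamma> \<omega> s)) \<Omega>' a' b' m'"
proof -
  let ?g = "inv_into \<Omega> \<phi>"
  note op = \<open>open \<Omega>\<close>
  have hol: "\<phi> holomorphic_on \<Omega>" and inj: "inj_on \<phi> \<Omega>" and im: "\<Omega>' = \<phi> ` \<Omega>"
    using \<open>conformal_map \<Omega> \<Omega>' \<phi>\<close> by (auto simp: conformal_map_def bij_betw_def)
  have g_\<phi>: "?g (\<phi> z) = z" if "z \<in> \<Omega>" for z using inj that by simp
  have ofS: "open \<Omega>'" unfolding im by (rule open_mapping_thm3[OF hol op inj])
  obtain h where h: "h holomorphic_on \<phi> ` \<Omega>"
      "\<And>z. z \<in> \<Omega> \<Longrightarrow> deriv \<phi> z * deriv h (\<phi> z) = 1" "\<And>z. z \<in> \<Omega> \<Longrightarrow> h (\<phi> z) = z"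
    using holomorphic_has_inverse[OF hol op inj] by blast
  have hg: "h w = ?g w" if "w \<in> \<Omega>'" for w using that h(3) g_\<phi> by (auto simp: im)
  have hol_g: "?g holomorphic_on \<Omega>'"
    using h(1) hg by (simp add: im cong: holomorphic_cong)
  \<comment> \<open>\<open>inv_into\<close> is unspecified off \<open>\<Omega>'\<close>, but
    \<open>deriv\<close> depends only on a neighbourhood, and \<open>\<Omega>'\<close> is
    open.\<close>
  have deriv_g: "deriv ?g (\<phi> z) = deriv h (\<phi> z)" if "z \<in> \<Omega>" for z
    using that hg ofS by (intro deriv_cong_ev eventually_nhds_in_open[THEN eventually_mono, of \<Omega>']) (auto simp: im)
  \<comment> \<open>The mass is given through the derivative of the inverse; multiplying by the
    Jacobian of \<open>\<phi>\<close> produces the product of the two derivatives, which is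
    \<open>1\<close>.\<close>
  have mass: "(cmod (deriv \<phi> z))\<^sup>2 * (m' (\<phi> z))\<^sup>2 = (m z)\<^sup>2" if "z \<in> \<Omega>" for z
  proof -
    have "(m' (\<phi> z))\<^sup>2 = (cmod (deriv h (\<phi> z)))\<^sup>2 * (m z)\<^sup>2"
      using assms(16) that by (simp add: im g_\<phi> deriv_g)
    then have "(cmod (deriv \<phi> z))\<^sup>2 * (m' (\<phi> z))\<^sup>2 = (cmod (deriv \<phi> z * deriv h (\<phi> z)))\<^sup>2 * (m z)\<^sup>2"
      by (simp add: norm_mult power_mult_distrib)
    then show ?thesis using h(2) that by simp
  qed
  from \<open>has_massive_SLE4_law M \<gamma> \<Omega> a b m\<close> obtain \<psi> F B W G where
    M: "prob_space M" and meas: "\<And>s. s \<in> {0<..<1} \<Longrightarrow> (\<lambda>\<omega>. \<gamma> \<omega> s) \<in> borel_measurable M"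
    and curve: "\<And>\<omega>. \<omega> \<in> space M \<Longrightarrow> curve_in \<Omega> a b (\<gamma> \<omega>)"
    and \<psi>: "conformal_map \<Omega> upper_half_plane \<psi>" "filtermap \<psi> a = H_zero" "filtermap \<psi> b = H_infinity"
    and BM: "brownian_motion M F B" "\<forall>t\<ge>0. W t \<in> borel_measurable (F t)"
    and path: "AE \<omega> in M. massive_loewner_path \<Omega> m \<psi> (\<gamma> \<omega>) (\<lambda>t. W t \<omega>) (\<lambda>t. B t \<omega>) (G \<omega>)"
    unfolding has_massive_SLE4_law_def by blast
  have in_\<Omega>: "\<gamma> \<omega> s \<in> \<Omega>" if "\<omega> \<in> space M" "s \<in> {0<..<1}" for \<omega> s
    using curve[OF that(1)] that(2) by (auto simp: curve_in_def)
  have conf: "conformal_map \<Omega>' upper_half_plane (\<psi> \<circ> ?g)"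
  proof -
    have "bij_betw ?g \<Omega>' \<Omega>"
      using inj im by (simp add: bij_betw_inv_into bij_betw_def inj_on_inv_into)
    then have "bij_betw (\<psi> \<circ> ?g) \<Omega>' upper_half_plane" "?g ` \<Omega>' \<subseteq> \<Omega>"
      using \<psi>(1) bij_betw_trans[of ?g \<Omega>' \<Omega> \<psi>] by (simp_all add: conformal_map_def bij_betw_imp_surj_on)
    then show ?thesis
      using \<psi>(1) hol_g by (auto simp: conformal_map_def intro: holomorphic_on_compose_gen)
  qed
  \<comment> \<open>\<open>?g\<close> undoes \<open>\<phi>\<close> only on \<open>\<Omega>\<close>,
    but eventually along \<open>x\<close> this is where the points lie, and maps that agree
    eventually have the same image filter.\<close>
  have filter_g: "filtermap (\<psi> \<circ> ?g) (filtermap \<phi> x) = filtermap \<psi> x" if "prime_end \<Omega> x" for x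
  proof -
    have "eventually (\<lambda>z. z \<in> \<Omega>) x"
      using prime_end_le_principal[OF that] by (simp add: le_principal)
    then have "eventually (\<lambda>z. (\<psi> \<circ> ?g) (\<phi> z) = \<psi> z) x"
      by (rule eventually_mono) (simp add: g_\<phi>)
    then have "eventually (\<lambda>z. P ((\<psi> \<circ> ?g) (\<phi> z)) \<longleftrightarrow> P (\<psi> z)) x" for P
      by (rule eventually_mono) simp
    then show ?thesis
      unfolding filter_eq_iff eventually_filtermap by (intro allI eventually_subst)
  qed
  have ends: "filtermap (\<psi> \<circ> ?g) a' = H_zero" "filtermap (\<psi> \<circ> ?g) b' = H_infinity"
    using filter_g[OF \<open>prime_end \<Omega> a\<close>] filter_g[OF \<open>prime_end \<Omega> b\<close>] \<psi>(2,3)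
      \<open>filtermap \<phi> a = a'\<close> \<open>filtermap \<phi> b = b'\<close> by simp_all
  have meas': "(\<lambda>\<omega>. \<phi> (\<gamma> \<omega> s)) \<in> borel_measurable M" if s: "s \<in> {0<..<1}" for s
  proof -
    \<comment> \<open>Continuity of \<open>\<phi>\<close> is available on \<open>\<Omega>\<close>
      alone, so the curve point is first viewed as a random element of \<open>\<Omega>\<close>; it
      lies there for every \<open>\<omega>\<close> in \<open>space M\<close>.\<close>
    have "(\<lambda>\<omega>. \<gamma> \<omega> s) \<in> M \<rightarrow>\<^sub>M restrict_space borel \<Omega>"
      using meas[OF s] in_\<Omega> s by (intro measurable_restrict_space2) auto
    then show ?thesis
      using borel_measurable_continuous_on_restrict[OF holomorphic_on_imp_continuous_on[OF hol]]
      by (rule measurable_compose)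
  qed
  have curve': "curve_in \<Omega>' a' b' (\<lambda>s. \<phi> (\<gamma> \<omega> s))" if \<omega>: "\<omega> \<in> space M" for \<omega>
  proof -
    \<comment> \<open>Image prime ends are image filters, so convergence at both ends is a
      composition of limits.\<close>
    have lim: "filterlim (\<lambda>s. \<phi> (\<gamma> \<omega> s)) (filtermap \<phi> x) H" if "filterlim (\<gamma> \<omega>) x H" for x H
      using that by (rule filterlim_compose[rotated]) (simp add: filterlim_def)
    show ?thesis
      using curve[OF \<omega>] in_\<Omega>[OF \<omega>] lim \<open>filtermap \<phi> a = a'\<close> \<open>filtermap \<phi> b = b'\<close> unfolding curve_in_def
      by (auto simp: im intro: continuous_on_compose2[OF holomorphic_on_imp_continuous_on[OF hol]])
  qed
  have path': "AE \<omega> in M. massive_loewner_path \<Omega>' m' (\<psi> \<circ> ?g) (\<lambda>s. \<phi> (\<gamma> \<omega> s))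
      (\<lambda>t. W t \<omega>) (\<lambda>t. B t \<omega>) (\<lambda>t z w. G \<omega> t (?g z) (?g w))"
    \<comment> \<open>\<open>AE_space\<close> supplies \<open>\<omega> \<in> space M\<close>, which
      keeps the curve inside \<open>\<Omega>\<close>.\<close>
    using path AE_space
  proof eventually_elim
    case (elim \<omega>)
    show ?case
      unfolding im using in_\<Omega> elim
      by (intro massive_loewner_path_conformal_image[OF hol op inj mass]) auto
  qed
  show ?thesis
    unfolding has_massive_SLE4_law_def
    \<comment> \<open>Filtration, Brownian motion and driving process are the old ones; the
      uniformizing map and both arguments of the Green function are precomposed with
      \<open>?g\<close>.\<close>
    by (intro conjI ballI exI[of _ "\<psi> \<circ> ?g"] exI[of _ F] exI[of _ B] exI[of _ W]
        exI[of _ "\<lambda>\<omega> t z w. G \<omega> t (?g z) (?g w)"] M meas' curve' conf ends BM path')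
qed

end
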